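(* Call a permutation $\pi$ triangular if $\pi_1=1$ and its consecutive-minima polygon $P_\pi$ has at most $3$ faces. For each $n\ge 0$, the number of triangular permutations of length $n+2$ is $\binom{2n}{n}$. Moreover, letting $t_{n;1,a}$ denote the number of triangular permutations $\pi$ of length $n$ with $\pi_1=1$ and $\pi_2=a$, the generating function $t(v;x)=\sum_{n\geq 2}\sum_{a=2}^{n}t_{n;1,a}v^{a-2}x^{n}$ is given by $$t(v;x)=\frac{x^{2}(1-v)(1-xv)^{2}}{(1-2xv)(1-v+xv^{2})}+\frac{x^{3}}{1-v+xv^{2}}\cdot \frac{1}{\sqrt{1-4x}}.$$
   Context: A permutation $\pi=\pi_1\pi_2\cdots\pi_n$ of $[n]=\{1,\dots,n\}$ is identified with the set of grid points $L_\pi=\{(i,\pi_i): 1\le i\le n\}$. A point $(i,j)\in L_\pi$ is a left-right minimum if there is no $(i',j')\in L_\pi$ with $i'<i$ and $j'<j$; it is a right-left minimum if there is no $(i',j')\in L_\pi$ with $i'>i$ and $j'<j$; it is a source if $i=1$, or $i=n$, or it is neither a left-right minimum nor a right-left minimum. Two points $(i,j),(i',j')$ of one of these three sets are consecutive (in that set) if no point $(a,b)$ of the same set satisfies $i<a<i'$ or $i'<a<i$. The consecutive-minima polygon $P_\pi$ has vertex set $L_\pi$, and two vertices $(i,j),(i',j')$ with $i<i'$ are joined by an edge if they are consecutive left-right minima, or consecutive right-left minima, or consecutive sources. An edge $((i,j),(i',j'))$ with $i<i'$ is increasing if $j<j'$ and decreasing if $j>j'$. A path is a sequence of edges $(a_0,a_1),(a_1,a_2),\dots,(a_{s-1},a_s)$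 of $P_\pi$. A face of $P_\pi$ is either a maximal path of increasing edges or a maximal path of decreasing edges; the number of faces of $P_\pi$ is the number of such maximal paths. *)

theory Defs
  imports
    "HOL-Library.Sublist"
    "HOL-Combinatorics.Permutations"
    "HOL-Computational_Algebra.Formal_Laurent_Series"
begin

type_synonym point = "nat \<times> nat"
type_synonym edge = "point \<times> point"

definition perm_points :: "nat \<Rightarrow> (nat \<Rightarrow> nat) \<Rightarrow> point set" where
  "perm_points n \<pi> = {(i, \<pi> i) | i. 1 \<le> i \<and> i \<le> n}"

definition lr_minima :: "nat \<Rightarrow> (nat \<Rightarrow> nat) \<Rightarrow> point set" where
  "lr_minima n \<pi> = {(i, j) \<in> perm_points n \<pi>.
     \<not> (\<exists>(i', j') \<in> perm_points n \<pi>. i' < i \<and> j' < j)}"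

definition rl_minima :: "nat \<Rightarrow> (nat \<Rightarrow> nat) \<Rightarrow> point set" where
  "rl_minima n \<pi> = {(i, j) \<in> perm_points n \<pi>.
     \<not> (\<exists>(i', j') \<in> perm_points n \<pi>. i' > i \<and> j' < j)}"

definition sources :: "nat \<Rightarrow> (nat \<Rightarrow> nat) \<Rightarrow> point set" where
  "sources n \<pi> = {(i, j) \<in> perm_points n \<pi>.
     i = 1 \<or> i = n \<or> ((i, j) \<notin> lr_minima n \<pi> \<and> (i, j) \<notin> rl_minima n \<pi>)}"

definition consecutive_in :: "point set \<Rightarrow> point \<Rightarrow> point \<Rightarrow> bool" where
  "consecutive_in S p q \<longleftrightarrow> p \<in> S \<and> q \<in> S \<and>
     \<not> (\<exists>(a, b) \<in> S. (fst p < a \<and> a < fst q) \<or> (fst q < a \<and> a < fst p))"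

definition polygon_edges :: "nat \<Rightarrow> (nat \<Rightarrow> nat) \<Rightarrow> edge set" where
  "polygon_edges n \<pi> = {(p, q). fst p < fst q \<and>
     (consecutive_in (lr_minima n \<pi>) p q \<or>
      consecutive_in (rl_minima n \<pi>) p q \<or>
      consecutive_in (sources n \<pi>) p q)}"

definition increasing_edges :: "nat \<Rightarrow> (nat \<Rightarrow> nat) \<Rightarrow> edge set" where
  "increasing_edges n \<pi> = {(p, q) \<in> polygon_edges n \<pi>. snd p < snd q}"

definition decreasing_edges :: "nat \<Rightarrow> (nat \<Rightarrow> nat) \<Rightarrow> edge set" where
  "decreasing_edges n \<pi> = {(p, q) \<in> polygon_edges n \<pi>. snd p > snd q}"

text \<open>
  Since edges are stored with the left endpoint first, paths run from left to right: two increasing edges that leave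
  the leftmost point of the polygon, or that enter its rightmost point, belong to different paths.
\<close>

definition is_path :: "edge set \<Rightarrow> edge list \<Rightarrow> bool" where
  "is_path E es \<longleftrightarrow> es \<noteq> [] \<and> set es \<subseteq> E \<and> successively (\<lambda>e f. snd e = fst f) es"

definition maximal_path :: "edge set \<Rightarrow> edge list \<Rightarrow> bool" where
  "maximal_path E es \<longleftrightarrow> is_path E es \<and> (\<forall>es'. is_path E es' \<and> sublist es es' \<longrightarrow> es' = es)"

definition faces :: "nat \<Rightarrow> (nat \<Rightarrow> nat) \<Rightarrow> edge list set" where
  "faces n \<pi> = {es. maximal_path (increasing_edges n \<pi>) es \<or>
                    maximal_path (decreasing_edges n \<pi>) es}"

definition triangular :: "nat \<Rightarrow> (nat \<Rightarrow> nat) \<Rightarrow> bool" where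
  "triangular n \<pi> \<longleftrightarrow> \<pi> permutes {1..n} \<and> \<pi> 1 = 1 \<and> card (faces n \<pi>) \<le> 3"

definition tri_count :: "nat \<Rightarrow> nat \<Rightarrow> nat" where
  "tri_count n a = card {\<pi>. triangular n \<pi> \<and> \<pi> 1 = 1 \<and> \<pi> 2 = a}"

text \<open>
  Bivariate series are power series in \<open>x\<close> whose coefficients are formal Laurent series in \<open>v\<close>.
  This ring contains the power series in \<open>v\<close> and \<open>x\<close>, and as the coefficients form a field,
  the division of power series and \<^const>\<open>fps_radical\<close> apply to it directly.
\<close>

definition var_v :: "rat fls fps" where
  "var_v = fps_const fls_X"

definition var_x :: "rat fls fps" where
  "var_x = fps_X"

definition tri_gf :: "rat fls fps" where
  "tri_gf = Abs_fps (\<lambda>n. if n \<ge> 2 then \<Sum>a=2..n. of_nat (tri_count n a) * fls_X ^ (a - 2) else 0)"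

text \<open>
  The square root with constant term \<open>1\<close> of a series with constant term \<open>1\<close>; the first argument
  of \<^const>\<open>fps_radical\<close> selects the root of the constant term.
\<close>

definition fps_sqrt1 :: "'a::field_char_0 fps \<Rightarrow> 'a fps" where
  "fps_sqrt1 f = fps_radical (\<lambda>_ _. 1) 2 f"

end

theory Submission
  imports Defs "HOL-Combinatorics.Multiset_Permutations"
begin

text \<open>
  If \<open>\<pi> 1 = 1\<close>, then \<open>(1, 1)\<close> is the only left-right minimum and the polygon is the union of two chains from
  \<open>(1, 1)\<close> to \<open>(n, \<pi> n)\<close>: the right-left minima, which form one increasing face, and the sources. Hence there are
  at most three faces iff the source chain changes direction at most once, that is, iff it has no valley.
  Since the largest of the entries behind a given position is always a source, this says that no entry
  is followed both by a smaller and by a larger one while being preceded by a larger one.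

  Call an entry with a smaller and a larger entry behind it a blocker. Building the word
  \<open>\<pi> 2 - 2, \<dots>, \<pi> n - 2\<close> from right to left, a new first entry of relative rank \<open>a\<close> is allowed iff no blocker is below
  \<open>a\<close>, and it becomes a blocker itself unless it is the least or the greatest entry. So the number \<open>F m c\<close> of
  admissible words of length \<open>m\<close> with all blockers \<open>\<ge> c\<close> satisfies \<open>F (m+1) c = F m (c-1) + \<dots> + F m m\<close> for
  \<open>1 \<le> c \<le> m\<close>, while \<open>F (m+1) 0 = F (m+1) 1\<close>. The solution is a sum of consecutive binomial coefficients of
  one row, which is central for \<open>c = 0\<close>; and the differences in \<open>c\<close> give the kernel equation for the
  generating function, as \<open>F (n-2) (a-2)\<close> triangular permutations have \<open>\<pi> 2 = a\<close>.
\<close>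

section \<open>Maximal paths\<close>

definition start_edges :: "edge set \<Rightarrow> edge set" where
  "start_edges E = {e \<in> E. \<forall>f\<in>E. snd f \<noteq> fst e}"

lemma not_is_path_Nil [simp]: "\<not> is_path E []"
  by (simp add: is_path_def)

lemma is_path_Cons:
  "is_path E (e # es) \<longleftrightarrow> e \<in> E \<and> (es = [] \<or> is_path E es \<and> snd e = fst (hd es))"
  by (cases es) (auto simp: is_path_def)

lemma hd_path_in_edges: "is_path E es \<Longrightarrow> hd es \<in> E"
  by (cases es) (auto simp: is_path_Cons)

lemma is_path_append_lastD:
  assumes "is_path E (ps @ es)" "ps \<noteq> []" "es \<noteq> []"
  shows "last ps \<in> E" "snd (last ps) = fst (hd es)"
  using assms by (auto simp: is_path_def successively_append_iff)

lemma hd_maximal_path_in_start_edges: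
  assumes "maximal_path E es"
  shows "hd es \<in> start_edges E"
proof -
  have path: "is_path E es"
    using assms by (simp add: maximal_path_def)
  have "snd f \<noteq> fst (hd es)" if "f \<in> E" for f
  proof
    assume "snd f = fst (hd es)"
    then have "is_path E (f # es)"
      using path that by (simp add: is_path_Cons)
    moreover have "sublist es (f # es)"
      by (simp add: sublist_Cons_right)
    ultimately have "f # es = es"
      using assms unfolding maximal_path_def by blast
    then show False by simp
  qed
  then show ?thesis
    using hd_path_in_edges[OF path] by (simp add: start_edges_def)
qed

locale unbranching_edges =
  fixes E :: "edge set"
  assumes finite_edges: "finite E"
    and left_to_right: "e \<in> E \<Longrightarrow> fst (fst e) < fst (snd e)"
    and unique_continuation:
      "\<lbrakk>e \<in> E; f \<in> E; g \<in> E; snd e = fst f; snd e = fst g\<rbrakk> \<Longrightarrow> f = g"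
begin

lemma unbranching_edges_subset:
  assumes "F \<subseteq> E"
  shows "unbranching_edges F"
proof
  show "finite F"
    using assms finite_edges by (rule finite_subset)
  show "fst (fst e) < fst (snd e)" if "e \<in> F" for e
    using that assms by (intro left_to_right) auto
  show "f = g" if "e \<in> F" "f \<in> F" "g \<in> F" "snd e = fst f" "snd e = fst g" for e f g
    using that assms by (intro unique_continuation[of e]) auto
qed

lemma distinct_path:
  assumes "is_path E es"
  shows "distinct es"
proof -
  have "successively (\<lambda>e f. fst (fst e) < fst (fst f)) es"
  proof (rule successively_mono)
    show "successively (\<lambda>e f. snd e = fst f) es"
      using assms by (simp add: is_path_def)
    show "fst (fst e) < fst (fst f)" if "e \<in> set es" "f \<in> set es" "snd e = fst f" for e f
      using left_to_right[of e] that assms by (auto simp: is_path_def)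
  qed
  then have "sorted_wrt (\<lambda>e f. fst (fst e) < fst (fst f)) es"
    by (subst (asm) successively_conv_sorted_wrt) (auto simp: transp_def)
  then show ?thesis
    by (induction es) auto
qed

lemma length_path_le:
  assumes "is_path E es"
  shows "length es \<le> card E"
  using assms distinct_path[OF assms] finite_edges
  by (metis card_mono distinct_card is_path_def)

lemma paths_prefix_cases:
  "\<lbrakk>is_path E es; is_path E fs; hd es = hd fs\<rbrakk> \<Longrightarrow> prefix es fs \<or> prefix fs es"
proof (induction es arbitrary: fs)
  case (Cons e es)
  from Cons.prems obtain gs where fs: "fs = e # gs"
    by (cases fs) auto
  show ?case
  proof (cases "es = [] \<or> gs = []")
    case False
    then have paths: "e \<in> E" "is_path E es" "snd e = fst (hd es)" "is_path E gs" "snd e = fst (hd gs)"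
      using Cons.prems by (auto simp: fs is_path_Cons)
    then have "hd es = hd gs"
      by (intro unique_continuation[of e] hd_path_in_edges)
    then show ?thesis
      using Cons.IH paths by (simp add: fs)
  qed (auto simp: fs)
qed simp

lemma ex_maximal_path_from_start_edge:
  assumes start: "e \<in> start_edges E"
  obtains es where "maximal_path E es" "hd es = e"
proof -
  define from_e where "from_e es \<longleftrightarrow> is_path E es \<and> hd es = e" for es
  have "from_e [e]"
    using start by (simp add: from_e_def is_path_Cons start_edges_def)
  moreover have "\<forall>es. from_e es \<longrightarrow> length es < Suc (card E)"
    using length_path_le by (auto simp: from_e_def less_Suc_eq_le)
  ultimately obtain es where es: "from_e es"
    and longest: "\<And>fs. from_e fs \<Longrightarrow> length fs \<le> length es"
    using ex_has_greatest_nat[of from_e "[e]" length] by blast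
  have "es' = es" if es': "is_path E es'" "sublist es es'" for es'
  proof -
    obtain ps ss where split: "es' = ps @ es @ ss"
      using es'(2) by (auto simp: sublist_def)
    have nonempty: "es \<noteq> []"
      using es by (auto simp: from_e_def)
    have "ps = []"
      using is_path_append_lastD[of E ps "es @ ss"] start es es'(1) split nonempty
      by (auto simp: from_e_def start_edges_def)
    then have "from_e es'"
      using es es'(1) split nonempty by (simp add: from_e_def)
    then show ?thesis
      using longest[of es'] split \<open>ps = []\<close> by simp
  qed
  then have "maximal_path E es"
    using es by (simp add: from_e_def maximal_path_def)
  with that es show thesis
    by (simp add: from_e_def)
qed

lemma bij_betw_hd_maximal_paths: "bij_betw hd {es. maximal_path E es} (start_edges E)"
  unfolding bij_betw_def
proof
  show "inj_on hd {es. maximal_path E es}"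
  proof (rule inj_onI, unfold mem_Collect_eq)
    fix es fs assume maximal: "maximal_path E es" "maximal_path E fs" and "hd es = hd fs"
    then have "prefix es fs \<or> prefix fs es"
      using paths_prefix_cases by (simp add: maximal_path_def)
    then show "es = fs"
      using maximal prefix_imp_sublist unfolding maximal_path_def by blast
  qed
  show "hd ` {es. maximal_path E es} = start_edges E"
    using hd_maximal_path_in_start_edges ex_maximal_path_from_start_edge by blast
qed

lemma card_maximal_paths_Un:
  assumes "A \<subseteq> E" "B \<subseteq> E" "A \<inter> B = {}"
  shows "card {es. maximal_path A es \<or> maximal_path B es} = card (start_edges A \<union> start_edges B)"
proof -
  interpret A: unbranching_edges A
    using assms(1) by (rule unbranching_edges_subset)
  interpret B: unbranching_edges B
    using assms(2) by (rule unbranching_edges_subset)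
  have "start_edges A \<inter> start_edges B = {}"
    using assms(3) by (auto simp: start_edges_def)
  then have "bij_betw hd ({es. maximal_path A es} \<union> {es. maximal_path B es})
      (start_edges A \<union> start_edges B)"
    by (rule bij_betw_combine[OF A.bij_betw_hd_maximal_paths B.bij_betw_hd_maximal_paths])
  then show ?thesis
    by (simp add: bij_betw_same_card Collect_disj_eq)
qed

end

section \<open>Turns of a chain\<close>

definition adjacent_in :: "'a::linorder set \<Rightarrow> 'a \<Rightarrow> 'a \<Rightarrow> bool" where
  "adjacent_in A i j \<longleftrightarrow> i \<in> A \<and> j \<in> A \<and> i < j \<and> \<not> (\<exists>a\<in>A. i < a \<and> a < j)"

lemma ex_adjacent_in_left:
  assumes "finite A" "a \<in> A" "i \<in> A" "a < i"
  obtains h where "adjacent_in A h i"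
proof
  have "Max {b \<in> A. b < i} \<in> {b \<in> A. b < i}"
    using assms by (intro Max_in) auto
  moreover have "b \<le> Max {b \<in> A. b < i}" if "b \<in> A" "b < i" for b
    using assms that by simp
  ultimately show "adjacent_in A (Max {b \<in> A. b < i}) i"
    using assms by (auto simp: adjacent_in_def leD)
qed

lemma ex_adjacent_in_right:
  assumes "finite A" "a \<in> A" "i \<in> A" "i < a"
  obtains j where "adjacent_in A i j"
proof
  have "Min {b \<in> A. i < b} \<in> {b \<in> A. i < b}"
    using assms by (intro Min_in) auto
  moreover have "Min {b \<in> A. i < b} \<le> b" if "b \<in> A" "i < b" for b
    using assms that by simp
  ultimately show "adjacent_in A i (Min {b \<in> A. i < b})"
    using assms by (auto simp: adjacent_in_def leD)
qed

lemma adjacent_in_unique_left: "adjacent_in A h i \<Longrightarrow> adjacent_in A h' i \<Longrightarrow> h = h'"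
  unfolding adjacent_in_def by (metis linorder_neqE)

lemma adjacent_in_unique_right: "adjacent_in A i j \<Longrightarrow> adjacent_in A i j' \<Longrightarrow> j = j'"
  unfolding adjacent_in_def by (metis linorder_neqE)

definition local_maxima :: "('a::linorder \<Rightarrow> 'a \<Rightarrow> bool) \<Rightarrow> 'a set \<Rightarrow> 'a set" where
  "local_maxima R A = {i. \<exists>h j. adjacent_in A h i \<and> adjacent_in A i j \<and> R h i \<and> R j i}"

lemma ex_local_maximum_between:
  assumes A: "finite A" "a \<in> A" "b \<in> A" "c \<in> A" "a < b" "b < c"
    and R: "transp R" "asymp R" "totalp_on A R" and b: "R a b" "R c b"
  obtains i where "i \<in> local_maxima R A" "a < i" "i < c"
proof -
  let ?B = "{x \<in> A. a \<le> x \<and> x \<le> c}"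
  have "finite ?B" "b \<in> ?B" "transp_on ?B R" "totalp_on ?B R"
    using A R by (auto intro: transp_on_subset totalp_on_subset)
  then obtain i where i: "i \<in> ?B" and greatest: "\<And>x. x \<in> ?B \<Longrightarrow> x \<noteq> i \<Longrightarrow> R x i"
    using Finite_Set.bex_greatest_element[of ?B R] by blast
  have "i \<noteq> a" "i \<noteq> c"
    using b greatest[OF \<open>b \<in> ?B\<close>] A(5,6) \<open>asymp R\<close> by (auto dest: asympD)
  then have bounds: "i \<in> A" "a < i" "i < c"
    using i by auto
  obtain h where h: "adjacent_in A h i"
    using ex_adjacent_in_left A(1,2) bounds by blast
  obtain j where j: "adjacent_in A i j"
    using ex_adjacent_in_right A(1,4) bounds by blast
  have "h \<in> ?B" "h \<noteq> i" "j \<in> ?B" "j \<noteq> i"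
    using h j bounds A(2,4) by (auto simp: adjacent_in_def not_less[symmetric])
  then have "i \<in> local_maxima R A"
    using h j greatest by (auto simp: local_maxima_def)
  then show thesis
    using bounds that by blast
qed

abbreviation peaks :: "('a::linorder \<Rightarrow> 'b::linorder) \<Rightarrow> 'a set \<Rightarrow> 'a set" where
  "peaks f \<equiv> local_maxima (\<lambda>x y. f x < f y)"

abbreviation valleys :: "('a::linorder \<Rightarrow> 'b::linorder) \<Rightarrow> 'a set \<Rightarrow> 'a set" where
  "valleys f \<equiv> local_maxima (\<lambda>x y. f y < f x)"

definition turns :: "('a::linorder \<Rightarrow> 'b::linorder) \<Rightarrow> 'a set \<Rightarrow> 'a set" where
  "turns f A = peaks f A \<union> valleys f A"

lemma ex_peak_between:
  assumes "finite A" "inj_on f A" "a \<in> A" "b \<in> A" "c \<in> A" "a < b" "b < c" "f a < f b" "f c < f b"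
  obtains i where "i \<in> peaks f A" "a < i" "i < c"
proof (rule ex_local_maximum_between[of A a b c "\<lambda>x y. f x < f y"])
  show "totalp_on A (\<lambda>x y. f x < f y)"
    using assms(2) by (metis (mono_tags, lifting) inj_onD linorder_neqE totalp_onI)
qed (use assms in \<open>auto intro: transpI asympI\<close>)

lemma ex_valley_between:
  assumes "finite A" "inj_on f A" "a \<in> A" "b \<in> A" "c \<in> A" "a < b" "b < c" "f b < f a" "f b < f c"
  obtains i where "i \<in> valleys f A" "a < i" "i < c"
proof (rule ex_local_maximum_between[of A a b c "\<lambda>x y. f y < f x"])
  show "totalp_on A (\<lambda>x y. f y < f x)"
    using assms(2) by (metis (mono_tags, lifting) inj_onD linorder_neqE totalp_onI)
qed (use assms in \<open>auto intro: transpI asympI\<close>)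

lemma ex_valley_between_peaks:
  assumes fin: "finite A" and inj: "inj_on f A"
    and peaks: "i \<in> peaks f A" "k \<in> peaks f A" "i < k"
  obtains j where "j \<in> valleys f A"
proof -
  obtain r where r: "adjacent_in A i r" "f r < f i"
    using peaks(1) by (auto simp: local_maxima_def)
  obtain l where l: "adjacent_in A l k" "f l < f k"
    using peaks(2) by (auto simp: local_maxima_def)
  have A: "i \<in> A" "r \<in> A" "l \<in> A" "k \<in> A" and order: "i < r" "r \<le> k" "i \<le> l" "l < k"
    using r l peaks(3) by (auto simp: adjacent_in_def not_less[symmetric])
  show thesis
  proof (cases "f i < f k")
    case True
    then have "f r < f k" "r < k"
      using r order by (auto simp: less_le)
    then show thesis
      using ex_valley_between[OF fin inj, of i r k] A order r that by blast
  next
    case False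
    then have "f l < f i" "i < l"
      using l order by (auto simp: less_le)
    then show thesis
      using ex_valley_between[OF fin inj, of i l k] A order l that by blast
  qed
qed

lemma local_maxima_subset: "local_maxima R A \<subseteq> A"
  by (auto simp: local_maxima_def adjacent_in_def)

lemma turns_subset: "turns f A \<subseteq> A"
  by (simp add: turns_def local_maxima_subset)

lemma in_local_maxima_iff:
  assumes adj: "adjacent_in A h i" "adjacent_in A i j"
  shows "i \<in> local_maxima R A \<longleftrightarrow> R h i \<and> R j i"
proof
  assume "i \<in> local_maxima R A"
  then obtain h' j' where "adjacent_in A h' i" "adjacent_in A i j'" "R h' i" "R j' i"
    by (auto simp: local_maxima_def)
  then show "R h i \<and> R j i"
    using adj adjacent_in_unique_left[of A h' i h] adjacent_in_unique_right[of A i j' j] by simp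
qed (use adj in \<open>auto simp: local_maxima_def\<close>)

lemma in_turns_iff:
  assumes adj: "adjacent_in A h i" "adjacent_in A i j" and inj: "inj_on f A"
  shows "i \<in> turns f A \<longleftrightarrow> (f h < f i) \<noteq> (f i < f j)"
proof -
  have "f h \<noteq> f i" "f i \<noteq> f j"
    using adj inj by (auto simp: adjacent_in_def dest: inj_onD)
  then show ?thesis
    by (auto simp: turns_def in_local_maxima_iff[OF adj])
qed

lemma ex_peak_before_valley:
  assumes fin: "finite A" and inj: "inj_on f A" and p: "p \<in> A"
    and least: "\<And>x. x \<in> A \<Longrightarrow> x \<noteq> p \<Longrightarrow> p < x \<and> f p < f x"
    and v: "v \<in> valleys f A"
  obtains u where "u \<in> peaks f A" "u < v"
proof -
  obtain h where "adjacent_in A h v" and descent: "f v < f h"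
    using v by (auto simp: local_maxima_def)
  then have A: "h \<in> A" "v \<in> A" "h < v"
    by (auto simp: adjacent_in_def)
  have "v \<noteq> p"
    using least[of h] A by (metis less_asym less_irrefl)
  then have "h \<noteq> p"
    using least[of v] A(2) descent by auto
  then show thesis
    using ex_peak_between[OF fin inj p, of h v] least[of h] A descent that by blast
qed

lemma card_turns_le_1_iff:
  assumes fin: "finite A" and inj: "inj_on f A" and p: "p \<in> A"
    and least: "\<And>x. x \<in> A \<Longrightarrow> x \<noteq> p \<Longrightarrow> p < x \<and> f p < f x"
  shows "card (turns f A) \<le> 1 \<longleftrightarrow> valleys f A = {}"
proof
  assume at_most_one: "card (turns f A) \<le> 1"
  have "finite (turns f A)"
    using turns_subset fin by (rule finite_subset)
  then have "u = v" if "u \<in> peaks f A" "v \<in> valleys f A" for u v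
    using that at_most_one by (simp add: turns_def card_le_Suc0_iff_eq)
  then show "valleys f A = {}"
    using ex_peak_before_valley[OF assms] by (metis equals0I less_irrefl)
next
  assume no_valley: "valleys f A = {}"
  have "i = k" if "i \<in> peaks f A" "k \<in> peaks f A" for i k
    using that no_valley ex_valley_between_peaks[OF fin inj] by (cases i k rule: linorder_cases) blast+
  then show "card (turns f A) \<le> 1"
    using no_valley by (cases "finite (peaks f A)") (auto simp: turns_def card_le_Suc0_iff_eq)
qed

section \<open>Unblocked functions\<close>

definition blocking_positions :: "('a::linorder \<Rightarrow> 'b::linorder) \<Rightarrow> 'a set \<Rightarrow> 'a set" where
  "blocking_positions f S = {j \<in> S. (\<exists>k\<in>S. j < k \<and> f k < f j) \<and> (\<exists>k\<in>S. j < k \<and> f j < f k)}"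

definition unblocked :: "('a::linorder \<Rightarrow> 'b::linorder) \<Rightarrow> 'a set \<Rightarrow> bool" where
  "unblocked f S \<longleftrightarrow> (\<forall>j\<in>blocking_positions f S. \<forall>i\<in>S. i < j \<longrightarrow> f i \<le> f j)"

lemma blocking_positions_insert_least:
  assumes "\<forall>i\<in>S. p < i"
  shows "blocking_positions f (insert p S) =
    (if (\<exists>k\<in>S. f k < f p) \<and> (\<exists>k\<in>S. f p < f k) then {p} else {}) \<union> blocking_positions f S"
  using assms by (auto simp: blocking_positions_def dest: less_asym)

lemma unblocked_insert_least:
  assumes "\<forall>i\<in>S. p < i"
  shows "unblocked f (insert p S) \<longleftrightarrow> unblocked f S \<and> (\<forall>j\<in>blocking_positions f S. f p \<le> f j)"
proof -
  have "j \<in> S" if "j \<in> blocking_positions f S" for j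
    using that by (simp add: blocking_positions_def)
  then show ?thesis
    using assms unfolding unblocked_def blocking_positions_insert_least[OF assms]
    by (auto dest: less_asym)
qed

section \<open>Faces of the polygon\<close>

locale anchored_permutation =
  fixes n :: nat and \<pi> :: "nat \<Rightarrow> nat"
  assumes perm: "\<pi> permutes {1..n}" and fixes_one: "\<pi> 1 = 1" and two_le: "2 \<le> n"
begin

definition source_pos :: "nat set" where
  "source_pos = {i\<in>{1..n}. i = 1 \<or> i = n \<or> (\<exists>k\<in>{i<..n}. \<pi> k < \<pi> i)}"

definition rlmin_pos :: "nat set" where
  "rlmin_pos = {i\<in>{1..n}. \<forall>k\<in>{i<..n}. \<pi> i < \<pi> k}"

abbreviation pt :: "nat \<Rightarrow> point" where
  "pt i \<equiv> (i, \<pi> i)"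

lemma perm_eq_iff: "\<pi> i = \<pi> j \<longleftrightarrow> i = j"
  using permutes_inj[OF perm] by (auto simp: inj_def)

lemma inj_on_perm: "inj_on \<pi> A"
  by (simp add: inj_on_def perm_eq_iff)

lemma one_less_perm: "1 < i \<Longrightarrow> i \<le> n \<Longrightarrow> 1 < \<pi> i"
  using permutes_in_image[OF perm, of i] perm_eq_iff[of i 1] fixes_one by (auto simp: le_neq_implies_less)

lemma pos_subset: "source_pos \<subseteq> {1..n}" "rlmin_pos \<subseteq> {1..n}"
  by (auto simp: source_pos_def rlmin_pos_def)

lemma finite_pos [simp]: "finite source_pos" "finite rlmin_pos"
  by (simp_all add: source_pos_def rlmin_pos_def)

lemma ends_in_pos: "1 \<in> source_pos" "n \<in> source_pos" "1 \<in> rlmin_pos" "n \<in> rlmin_pos"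
  using two_le one_less_perm fixes_one by (auto simp: source_pos_def rlmin_pos_def)

lemma source_rlmin_pos_overlap: "i \<in> source_pos \<Longrightarrow> i \<in> rlmin_pos \<Longrightarrow> i = 1 \<or> i = n"
  by (auto simp: source_pos_def rlmin_pos_def dest: less_asym)

lemma source_or_rlmin_pos: "1 \<le> i \<Longrightarrow> i \<le> n \<Longrightarrow> i \<in> source_pos \<or> i \<in> rlmin_pos"
proof (rule disjCI)
  assume i: "1 \<le> i" "i \<le> n" "i \<notin> rlmin_pos"
  then obtain k where k: "k \<in> {i<..n}" "\<not> \<pi> i < \<pi> k"
    by (auto simp: rlmin_pos_def)
  then have "\<pi> k < \<pi> i"
    using perm_eq_iff[of i k] by auto
  then show "i \<in> source_pos"
    using i k by (auto simp: source_pos_def)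
qed

lemma perm_points_eq: "perm_points n \<pi> = pt ` {1..n}"
  by (auto simp: perm_points_def)

lemma rl_minima_eq: "rl_minima n \<pi> = pt ` rlmin_pos"
proof -
  have "(\<forall>k\<in>{i<..n}. \<pi> i < \<pi> k) \<longleftrightarrow> \<not> (\<exists>k\<in>{1..n}. i < k \<and> \<pi> k < \<pi> i)" if "1 \<le> i" for i
  proof -
    have "\<pi> i < \<pi> k \<longleftrightarrow> \<not> \<pi> k < \<pi> i" if "i < k" for k
      using perm_eq_iff[of i k] that by linarith
    then show ?thesis using that by force
  qed
  then show ?thesis
    unfolding rl_minima_def perm_points_eq rlmin_pos_def by (auto simp: image_iff)
qed

lemma lr_minima_eq: "lr_minima n \<pi> = {pt 1}"
proof -
  have "(\<exists>k\<in>{1..n}. k < i \<and> \<pi> k < \<pi> i) \<longleftrightarrow> i \<noteq> 1" if "1 \<le> i" "i \<le> n" for i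
    using that one_less_perm[of i] fixes_one by (auto intro!: bexI[of _ 1])
  then have "{i\<in>{1..n}. \<not> (\<exists>k\<in>{1..n}. k < i \<and> \<pi> k < \<pi> i)} = {1}"
    using two_le by auto
  moreover have "lr_minima n \<pi> = pt ` {i\<in>{1..n}. \<not> (\<exists>k\<in>{1..n}. k < i \<and> \<pi> k < \<pi> i)}"
    unfolding lr_minima_def perm_points_eq by auto
  ultimately show ?thesis by simp
qed

lemma sources_eq: "sources n \<pi> = pt ` source_pos"
proof -
  have "i = 1 \<or> i = n \<or> i \<notin> rlmin_pos \<longleftrightarrow> i \<in> source_pos" if "i \<in> {1..n}" for i
    using that source_or_rlmin_pos[of i] source_rlmin_pos_overlap[of i] ends_in_pos by auto
  then have "{i \<in> {1..n}. i = 1 \<or> i = n \<or> i \<notin> rlmin_pos} = source_pos"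
    using pos_subset(1) by blast
  moreover have "sources n \<pi> = pt ` {i \<in> {1..n}. i = 1 \<or> i = n \<or> i \<notin> rlmin_pos}"
    unfolding sources_def perm_points_eq lr_minima_eq rl_minima_eq by auto
  ultimately show ?thesis by simp
qed

definition edge_at :: "nat \<Rightarrow> nat \<Rightarrow> bool" where
  "edge_at i j \<longleftrightarrow> adjacent_in rlmin_pos i j \<or> adjacent_in source_pos i j"

lemma polygon_edges_eq: "polygon_edges n \<pi> = {(pt i, pt j) | i j. edge_at i j}"
proof -
  have "fst p < fst q \<and> consecutive_in (pt ` A) p q \<longleftrightarrow>
      (\<exists>i j. p = pt i \<and> q = pt j \<and> adjacent_in A i j)" for A p q
    unfolding consecutive_in_def adjacent_in_def by fastforce
  moreover have "\<not> (fst p < fst q \<and> consecutive_in {pt 1} p q)" for p q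
    by (auto simp: consecutive_in_def)
  ultimately show ?thesis
    unfolding polygon_edges_def lr_minima_eq rl_minima_eq sources_eq edge_at_def
    by (simp only: conj_disj_distribL) blast
qed

lemma edge_at_bounds:
  assumes "edge_at i j"
  shows "1 \<le> i" "i < j" "j \<le> n"
  using assms pos_subset by (auto simp: edge_at_def adjacent_in_def)

lemma edge_at_interior_iff:
  assumes "A = source_pos \<or> A = rlmin_pos" "i \<in> A" "1 < i" "i < n"
  shows "edge_at i j \<longleftrightarrow> adjacent_in A i j" "edge_at h i \<longleftrightarrow> adjacent_in A h i"
  using source_rlmin_pos_overlap[of i] assms by (auto simp: edge_at_def adjacent_in_def)

lemma edge_at_unique_right:
  assumes "1 < i" and edges: "edge_at i j" "edge_at i j'"
  shows "j = j'"
proof -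
  have "i < n"
    using edge_at_bounds[OF edges(1)] by simp
  then obtain A where "A = source_pos \<or> A = rlmin_pos" "i \<in> A"
    using source_or_rlmin_pos[of i] \<open>1 < i\<close> by auto
  then have "adjacent_in A i j" "adjacent_in A i j'"
    using edge_at_interior_iff(1)[of A i] edges \<open>1 < i\<close> \<open>i < n\<close> by blast+
  then show ?thesis
    by (rule adjacent_in_unique_right)
qed

lemma unbranching_polygon_edges: "unbranching_edges (polygon_edges n \<pi>)"
proof
  have "polygon_edges n \<pi> \<subseteq> pt ` {1..n} \<times> pt ` {1..n}"
    using edge_at_bounds by (force simp: polygon_edges_eq)
  then show "finite (polygon_edges n \<pi>)"
    by (rule finite_subset) simp
next
  show "fst (fst e) < fst (snd e)" if "e \<in> polygon_edges n \<pi>" for e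
    using that edge_at_bounds(2) by (auto simp: polygon_edges_eq)
next
  fix e f g
  assume edges: "e \<in> polygon_edges n \<pi>" "f \<in> polygon_edges n \<pi>" "g \<in> polygon_edges n \<pi>"
    and incident: "snd e = fst f" "snd e = fst g"
  then obtain h i j j' where "edge_at h i" "f = (pt i, pt j)" "edge_at i j" "g = (pt i, pt j')" "edge_at i j'"
    by (auto simp: polygon_edges_eq)
  moreover from this have "1 < i"
    using edge_at_bounds[of h i] by simp
  ultimately show "f = g"
    using edge_at_unique_right by blast
qed

definition face_starts :: "edge set" where
  "face_starts = start_edges (increasing_edges n \<pi>) \<union> start_edges (decreasing_edges n \<pi>)"

lemma card_faces_eq_card_face_starts: "card (faces n \<pi>) = card face_starts"
  unfolding faces_def face_starts_def
  by (rule unbranching_edges.card_maximal_paths_Un[OF unbranching_polygon_edges])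
    (auto simp: increasing_edges_def decreasing_edges_def)

lemma turn_interior:
  assumes "i \<in> turns \<pi> source_pos"
  shows "1 < i" "i < n" "i \<in> source_pos"
  using assms pos_subset(1) by (fastforce simp: turns_def local_maxima_def adjacent_in_def)+

lemma first_edge_of_face_iff:
  assumes edge: "edge_at i j"
  shows "(\<forall>h. edge_at h i \<longrightarrow> (\<pi> h < \<pi> i) \<noteq> (\<pi> i < \<pi> j)) \<longleftrightarrow> i = 1 \<or> i \<in> turns \<pi> source_pos"
proof -
  note bounds = edge_at_bounds[OF edge]
  then consider (one) "i = 1" | (source) "1 < i" "i < n" "i \<in> source_pos"
    | (rlmin) "1 < i" "i < n" "i \<in> rlmin_pos" "i \<notin> source_pos"
    using source_or_rlmin_pos[of i] by fastforce
  then show ?thesis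
  proof cases
    case one
    then show ?thesis
      using edge_at_bounds[of _ i] by fastforce
  next
    case source
    have source_edge: "edge_at i k \<longleftrightarrow> adjacent_in source_pos i k"
      "edge_at k i \<longleftrightarrow> adjacent_in source_pos k i" for k
      using edge_at_interior_iff[of source_pos i] source by auto
    obtain h where h: "adjacent_in source_pos h i"
      using ex_adjacent_in_left[of source_pos 1 i] source ends_in_pos by auto
    then have "edge_at h' i \<longleftrightarrow> h' = h" for h'
      using source_edge(2) adjacent_in_unique_left by blast
    then show ?thesis
      using source_edge(1) edge in_turns_iff[OF h _ inj_on_perm] source by simp
  next
    case rlmin
    obtain h where h: "adjacent_in rlmin_pos h i"
      using ex_adjacent_in_left[of rlmin_pos 1 i] rlmin ends_in_pos by auto
    then have "\<pi> h < \<pi> i" "\<pi> i < \<pi> j" "edge_at h i"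
      using rlmin bounds by (auto simp: adjacent_in_def rlmin_pos_def edge_at_def)
    then show ?thesis
      using rlmin turn_interior(3) by auto
  qed
qed

lemma face_starts_eq:
  "face_starts = {(pt i, pt j) | i j. edge_at i j \<and> (i = 1 \<or> i \<in> turns \<pi> source_pos)}"
proof -
  have inc: "increasing_edges n \<pi> = {(pt i, pt j) | i j. edge_at i j \<and> \<pi> i < \<pi> j}"
    and dec: "decreasing_edges n \<pi> = {(pt i, pt j) | i j. edge_at i j \<and> \<pi> j < \<pi> i}"
    unfolding increasing_edges_def decreasing_edges_def polygon_edges_eq by auto
  have start_inc: "start_edges (increasing_edges n \<pi>) = {(pt i, pt j) | i j. edge_at i j \<and> \<pi> i < \<pi> j \<and>
      (\<forall>h. edge_at h i \<longrightarrow> \<not> \<pi> h < \<pi> i)}"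
    unfolding start_edges_def inc by fastforce
  have start_dec: "start_edges (decreasing_edges n \<pi>) = {(pt i, pt j) | i j. edge_at i j \<and> \<pi> j < \<pi> i \<and>
      (\<forall>h. edge_at h i \<longrightarrow> \<not> \<pi> i < \<pi> h)}"
    unfolding start_edges_def dec by fastforce
  have "\<pi> i < \<pi> j \<longleftrightarrow> \<not> \<pi> j < \<pi> i" if "edge_at i j" for i j
    using edge_at_bounds(2)[OF that] perm_eq_iff[of i j] by linarith
  then have "face_starts =
      {(pt i, pt j) | i j. edge_at i j \<and> (\<forall>h. edge_at h i \<longrightarrow> (\<pi> h < \<pi> i) \<noteq> (\<pi> i < \<pi> j))}"
    unfolding face_starts_def start_inc start_dec by blast
  then show ?thesis
    using first_edge_of_face_iff by auto
qed

lemma card_edges_from_one: "card {j. edge_at 1 j} = (if n = 2 then 1 else 2)"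
proof -
  obtain r where r: "adjacent_in rlmin_pos 1 r"
    using ex_adjacent_in_right[of rlmin_pos n 1] two_le ends_in_pos by auto
  obtain s where s: "adjacent_in source_pos 1 s"
    using ex_adjacent_in_right[of source_pos n 1] two_le ends_in_pos by auto
  have edges: "{j. edge_at 1 j} = {r, s}"
    using r s adjacent_in_unique_right by (auto simp: edge_at_def)
  have "r = s \<longleftrightarrow> n = 2"
  proof
    assume "r = s"
    then have "r = n"
      using source_rlmin_pos_overlap[of r] r s by (auto simp: adjacent_in_def)
    then show "n = 2"
      using source_or_rlmin_pos[of 2] r s two_le \<open>r = s\<close> by (force simp: adjacent_in_def)
  next
    assume "n = 2"
    moreover have "edge_at 1 r" "edge_at 1 s"
      using r s by (simp_all add: edge_at_def)
    ultimately show "r = s"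
      using edge_at_bounds(2,3)[of 1 r] edge_at_bounds(2,3)[of 1 s] by linarith
  qed
  then show ?thesis
    unfolding edges by (simp add: card_insert_if)
qed

lemma card_edges_from_turn:
  assumes "i \<in> turns \<pi> source_pos"
  shows "card {j. edge_at i j} = 1"
proof -
  obtain j where "edge_at i j"
    using assms by (auto simp: turns_def local_maxima_def edge_at_def)
  then have "{j. edge_at i j} = {j}"
    using edge_at_unique_right turn_interior(1)[OF assms] by blast
  then show ?thesis by simp
qed

lemma card_faces_eq: "card (faces n \<pi>) = (if n = 2 then 1 else 2) + card (turns \<pi> source_pos)"
proof -
  let ?I = "insert 1 (turns \<pi> source_pos)"
  have fin: "finite (turns \<pi> source_pos)" "finite {j. edge_at i j}" for i
    by (rule finite_subset[OF turns_subset], simp)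
      (rule finite_subset[of _ "{..n}"], auto dest: edge_at_bounds(3))
  have "face_starts = map_prod pt pt ` (SIGMA i:?I. {j. edge_at i j})"
    unfolding face_starts_eq by (auto simp: image_iff)
  moreover have "inj (map_prod pt pt)"
    by (intro prod.inj_map) (auto simp: inj_def)
  ultimately have "card face_starts = card (SIGMA i:?I. {j. edge_at i j})"
    by (simp add: card_image inj_on_subset)
  also have "\<dots> = (\<Sum>i\<in>?I. card {j. edge_at i j})"
    using fin by simp
  also have "\<dots> = card {j. edge_at 1 j} + card (turns \<pi> source_pos)"
    using fin(1) turn_interior(1) card_edges_from_turn by (subst sum.insert) auto
  finally show ?thesis
    by (simp only: card_faces_eq_card_face_starts card_edges_from_one)
qed

lemma card_faces_le_3_iff: "card (faces n \<pi>) \<le> 3 \<longleftrightarrow> valleys \<pi> source_pos = {}"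
proof -
  have "n \<noteq> 2" if "i \<in> turns \<pi> source_pos" for i
    using turn_interior[OF that] by simp
  then have "turns \<pi> source_pos = {}" if "n = 2"
    using that by blast
  then have "card (faces n \<pi>) \<le> 3 \<longleftrightarrow> card (turns \<pi> source_pos) \<le> 1"
    by (auto simp: card_faces_eq)
  also have "\<dots> \<longleftrightarrow> valleys \<pi> source_pos = {}"
  proof (rule card_turns_le_1_iff)
    show "1 < x \<and> \<pi> 1 < \<pi> x" if "x \<in> source_pos" "x \<noteq> 1" for x
      using that pos_subset(1) one_less_perm[of x] fixes_one by fastforce
  qed (use ends_in_pos in \<open>simp_all add: inj_on_perm\<close>)
  finally show ?thesis .
qed

lemma ex_source_above:
  assumes "k \<in> {j<..n}"
  obtains k' where "k' \<in> source_pos" "j < k'" "\<pi> k \<le> \<pi> k'"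
proof -
  have "finite (\<pi> ` {j<..n})" "\<pi> ` {j<..n} \<noteq> {}"
    using assms by auto
  then obtain k' where k': "k' \<in> {j<..n}" "\<pi> k' = Max (\<pi> ` {j<..n})"
    using Max_in by (metis imageE)
  have max: "\<pi> x \<le> \<pi> k'" if "x \<in> {j<..n}" for x
    using that by (simp add: k'(2))
  have "k' \<in> source_pos"
  proof (cases "k' = n")
    case False
    then have "\<pi> n < \<pi> k'"
      using max[of n] k'(1) perm_eq_iff[of n k'] by (simp add: le_less)
    then show ?thesis
      using False k'(1) by (auto simp: source_pos_def)
  qed (simp add: ends_in_pos)
  then show thesis
    using that k'(1) max[OF assms] by simp
qed

lemma no_valley_if_unblocked:
  assumes unblocked: "unblocked \<pi> {1..n}"
  shows "valleys \<pi> source_pos = {}"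
proof (rule equals0I)
  fix j assume "j \<in> valleys \<pi> source_pos"
  then obtain h k where adj: "adjacent_in source_pos h j" "adjacent_in source_pos j k"
    and valley: "\<pi> j < \<pi> h" "\<pi> j < \<pi> k"
    by (auto simp: local_maxima_def)
  then have pos: "h \<in> {1..n}" "j \<in> {1..n}" "k \<in> {1..n}" "h < j" "j < k" "j \<in> source_pos"
    using pos_subset(1) by (auto simp: adjacent_in_def)
  then obtain l where "l \<in> {1..n}" "j < l" "\<pi> l < \<pi> j"
    by (auto simp: source_pos_def)
  then have "j \<in> blocking_positions \<pi> {1..n}"
    using pos valley unfolding blocking_positions_def by blast
  then show False
    using unblocked pos valley unfolding unblocked_def by fastforce
qed

lemma unblocked_if_no_valley:
  assumes no_valley: "valleys \<pi> source_pos = {}"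
  shows "unblocked \<pi> {1..n}"
  unfolding unblocked_def
proof (intro ballI impI, rule ccontr)
  fix i j assume j: "j \<in> blocking_positions \<pi> {1..n}" and i: "i \<in> {1..n}" "i < j" and "\<not> \<pi> i \<le> \<pi> j"
  then have above: "\<pi> j < \<pi> i" by simp
  obtain k l where k: "k \<in> {j<..n}" "\<pi> j < \<pi> k" and l: "l \<in> {j<..n}" "\<pi> l < \<pi> j"
    using j by (auto simp: blocking_positions_def)
  obtain k' where "k' \<in> source_pos" "j < k'" "\<pi> k \<le> \<pi> k'"
    using k(1) by (rule ex_source_above)
  moreover have "i \<in> source_pos" "j \<in> source_pos"
    using i l above by (auto simp: source_pos_def)
  ultimately show False
    using ex_valley_between[OF finite_pos(1) inj_on_perm, of i j k'] i(2) above k(2) no_valley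
    by (auto dest: less_le_trans)
qed

end

lemma triangular_iff_unblocked:
  assumes "2 \<le> n"
  shows "triangular n \<pi> \<longleftrightarrow> \<pi> permutes {1..n} \<and> \<pi> 1 = 1 \<and> unblocked \<pi> {1..n}"
proof -
  have "card (faces n \<pi>) \<le> 3 \<longleftrightarrow> unblocked \<pi> {1..n}" if "\<pi> permutes {1..n}" "\<pi> 1 = 1"
  proof -
    interpret anchored_permutation n \<pi>
      using that assms by unfold_locales
    show ?thesis
      using no_valley_if_unblocked unblocked_if_no_valley card_faces_le_3_iff by blast
  qed
  then show ?thesis
    by (auto simp: triangular_def)
qed

section \<open>Admissible words\<close>

primrec blockers :: "'a::linorder list \<Rightarrow> 'a set" where
  "blockers [] = {}"
| "blockers (x # w) = (if (\<exists>y\<in>set w. y < x) \<and> (\<exists>y\<in>set w. x < y) then {x} else {}) \<union> blockers w"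

primrec admissible :: "'a::linorder list \<Rightarrow> bool" where
  "admissible [] \<longleftrightarrow> True"
| "admissible (x # w) \<longleftrightarrow> admissible w \<and> (\<forall>b\<in>blockers w. x \<le> b)"

lemma blockers_map_strict_sorted:
  assumes "sorted_wrt (<) xs"
  shows "blockers (map f xs) = f ` blocking_positions f (set xs)"
  using assms
proof (induction xs)
  case (Cons p xs)
  then show ?case
    by (auto simp: blocking_positions_insert_least)
qed (simp add: blocking_positions_def)

lemma admissible_map_strict_sorted:
  assumes "sorted_wrt (<) xs"
  shows "admissible (map f xs) \<longleftrightarrow> unblocked f (set xs)"
  using assms
proof (induction xs)
  case (Cons p xs)
  then show ?case
    by (simp add: unblocked_insert_least blockers_map_strict_sorted)
qed (simp add: unblocked_def blocking_positions_def)

lemma blockers_subset: "blockers w \<subseteq> set w"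
  by (induction w) auto

lemma blockers_map:
  assumes "strict_mono f"
  shows "blockers (map f w) = f ` blockers w"
  by (induction w) (auto simp: strict_mono_less[OF assms])

lemma admissible_map:
  assumes "strict_mono f"
  shows "admissible (map f w) \<longleftrightarrow> admissible w"
  by (induction w) (auto simp: blockers_map assms strict_mono_less_eq[OF assms])

definition admissible_words :: "nat \<Rightarrow> nat list set" where
  "admissible_words m = {w \<in> permutations_of_set {..<m}. admissible w}"

definition raise :: "nat \<Rightarrow> nat \<Rightarrow> nat" where
  "raise a x = (if x < a then x else Suc x)"

definition prepend_rank :: "nat \<Rightarrow> nat list \<Rightarrow> nat list" where
  "prepend_rank a w = a # map (raise a) w"

lemma strict_mono_raise: "strict_mono (raise a)"
  by (auto simp: strict_mono_def raise_def)

lemma le_raise_iff: "a \<le> raise a b \<longleftrightarrow> a \<le> b"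
  by (simp add: raise_def)

lemma raise_image:
  assumes "a \<le> m"
  shows "raise a ` {..<m} = {..<Suc m} - {a}"
proof (intro equalityI subsetI)
  fix y assume y: "y \<in> {..<Suc m} - {a}"
  then have "y = raise a (if y < a then y else y - 1)" "(if y < a then y else y - 1) \<in> {..<m}"
    using assms by (auto simp: raise_def)
  then show "y \<in> raise a ` {..<m}" by blast
qed (use assms in \<open>auto simp: raise_def split: if_splits\<close>)

lemma inj_prepend_rank: "inj (prepend_rank a)"
  by (auto simp: inj_def prepend_rank_def inj_map_eq_map[OF strict_mono_imp_inj_on[OF strict_mono_raise]])

lemma permutations_of_set_lessThan_Suc:
  "permutations_of_set {..<Suc m} = (\<Union>a\<le>m. prepend_rank a ` permutations_of_set {..<m})"
proof -
  have "permutations_of_set ({..<Suc m} - {a}) = map (raise a) ` permutations_of_set {..<m}"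
    if "a \<le> m" for a
    using permutations_of_set_image_inj[OF strict_mono_imp_inj_on[OF strict_mono_raise], of a "{..<m}"]
      raise_image[OF that]
    by simp
  then have "permutations_of_set {..<Suc m} = (\<Union>a\<le>m. (#) a ` map (raise a) ` permutations_of_set {..<m})"
    by (subst permutations_of_set_nonempty) (auto simp: lessThan_Suc_atMost)
  then show ?thesis
    by (simp add: prepend_rank_def image_image)
qed

lemma blockers_prepend_rank:
  assumes "a \<le> m" "w \<in> permutations_of_set {..<m}"
  shows "blockers (prepend_rank a w) = (if 0 < a \<and> a < m then {a} else {}) \<union> raise a ` blockers w"
proof -
  have set: "set (map (raise a) w) = {..<Suc m} - {a}"
    using permutations_of_setD(1)[OF assms(2)] raise_image[OF assms(1)] by simp
  have "(\<exists>y\<in>{..<Suc m} - {a}. y < a) \<longleftrightarrow> 0 < a"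
    using assms(1) by (auto intro!: bexI[of _ 0])
  moreover have "(\<exists>y\<in>{..<Suc m} - {a}. a < y) \<longleftrightarrow> a < m"
    using assms(1) by (auto intro!: bexI[of _ m])
  ultimately show ?thesis
    by (simp only: prepend_rank_def blockers.simps set blockers_map[OF strict_mono_raise])
qed

definition words_free_below :: "nat \<Rightarrow> nat \<Rightarrow> nat list set" where
  "words_free_below m c = {w \<in> admissible_words m. \<forall>b\<in>blockers w. c \<le> b}"

definition count_free_below :: "nat \<Rightarrow> nat \<Rightarrow> nat" where
  "count_free_below m c = card (words_free_below m c)"

lemma words_free_below_subset: "words_free_below m c \<subseteq> permutations_of_set {..<m}"
  by (auto simp: words_free_below_def admissible_words_def)

lemma finite_words_free_below: "finite (words_free_below m c)"
  using words_free_below_subset by (rule finite_subset) simp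

lemma words_free_below_0: "words_free_below m 0 = admissible_words m"
  by (simp add: words_free_below_def)

lemma prepend_rank_in_admissible_words_iff:
  assumes "a \<le> m" "w \<in> permutations_of_set {..<m}"
  shows "prepend_rank a w \<in> admissible_words (Suc m) \<longleftrightarrow> w \<in> words_free_below m a"
proof -
  have "prepend_rank a w \<in> permutations_of_set {..<Suc m}"
    using assms by (auto simp: permutations_of_set_lessThan_Suc)
  moreover have "admissible (prepend_rank a w) \<longleftrightarrow> admissible w \<and> (\<forall>b\<in>blockers w. a \<le> b)"
    by (simp add: prepend_rank_def admissible_map blockers_map strict_mono_raise le_raise_iff)
  ultimately show ?thesis
    using assms(2) by (auto simp: admissible_words_def words_free_below_def)
qed

text \<open>
  A first entry of rank \<open>0\<close> raises all blockers by one, and one of the top rank \<open>m\<close> leaves no room for blockers.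
\<close>

lemma prepend_rank_in_words_free_below_iff:
  assumes a: "a \<le> m" and w: "w \<in> permutations_of_set {..<m}"
  shows "prepend_rank a w \<in> words_free_below (Suc m) c \<longleftrightarrow>
    (0 < a \<and> a < m \<longrightarrow> c \<le> a) \<and> w \<in> words_free_below m (if a = 0 then c - 1 else a)"
proof -
  have bound: "b < m" if "b \<in> blockers w" for b
    using that blockers_subset permutations_of_setD(1)[OF w] by blast
  have free: "prepend_rank a w \<in> words_free_below (Suc m) c \<longleftrightarrow>
      w \<in> words_free_below m a \<and> (0 < a \<and> a < m \<longrightarrow> c \<le> a) \<and> (\<forall>b\<in>blockers w. c \<le> raise a b)"
    using prepend_rank_in_admissible_words_iff[OF assms]
    by (auto simp: words_free_below_def[of "Suc m"] blockers_prepend_rank[OF assms])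
  show ?thesis
  proof (cases "a = 0")
    case True
    then show ?thesis
      unfolding free by (auto simp: words_free_below_def raise_def)
  next
    case False
    have "c \<le> raise a b" if "w \<in> words_free_below m a" "a < m \<longrightarrow> c \<le> a" "b \<in> blockers w" for b
      using that bound[of b] a by (auto simp: words_free_below_def raise_def)
    then show ?thesis
      unfolding free using False by auto
  qed
qed

lemma card_words_free_below_hd:
  assumes "a \<le> m"
  shows "card {w \<in> words_free_below (Suc m) c. hd w = a} =
    (if 0 < a \<and> a < m \<longrightarrow> c \<le> a then count_free_below m (if a = 0 then c - 1 else a) else 0)"
proof -
  have hd: "hd (prepend_rank b w) = b" for b w
    by (simp add: prepend_rank_def)
  have "{w \<in> words_free_below (Suc m) c. hd w = a} =
      prepend_rank a ` {w \<in> permutations_of_set {..<m}. prepend_rank a w \<in> words_free_below (Suc m) c}"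
    using words_free_below_subset[of "Suc m" c] assms by (auto simp: permutations_of_set_lessThan_Suc hd)
  also have "\<dots> = prepend_rank a ` (if 0 < a \<and> a < m \<longrightarrow> c \<le> a
      then words_free_below m (if a = 0 then c - 1 else a) else {})"
    using prepend_rank_in_words_free_below_iff[OF assms] subsetD[OF words_free_below_subset]
    by (intro arg_cong[where f = "image _"]) auto
  finally show ?thesis
    by (simp add: card_image inj_on_subset[OF inj_prepend_rank] count_free_below_def)
qed

lemma count_free_below_Suc:
  "count_free_below (Suc m) c =
    (\<Sum>a\<le>m. if 0 < a \<and> a < m \<longrightarrow> c \<le> a then count_free_below m (if a = 0 then c - 1 else a) else 0)"
proof -
  have "hd ` words_free_below (Suc m) c \<subseteq> {..m}"
    using words_free_below_subset[of "Suc m" c] by (auto simp: permutations_of_set_lessThan_Suc prepend_rank_def)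
  then have "count_free_below (Suc m) c = (\<Sum>a\<le>m. card {w \<in> words_free_below (Suc m) c. hd w = a})"
    unfolding count_free_below_def card_eq_sum
    by (intro sum.group[symmetric] finite_words_free_below) auto
  then show ?thesis
    by (simp add: card_words_free_below_hd)
qed

lemma count_free_below_0: "count_free_below 0 c = 1"
proof -
  have "words_free_below 0 c = {[]}"
    by (auto simp: words_free_below_def admissible_words_def)
  then show ?thesis
    by (simp add: count_free_below_def)
qed

lemma count_free_below_1_right: "count_free_below m 1 = count_free_below m 0"
  by (cases m) (auto simp: count_free_below_0 count_free_below_Suc intro!: sum.cong)

lemma count_free_below_Suc_self: "count_free_below (Suc m) (Suc m) = count_free_below (Suc m) m"
proof (induction m)
  case 0
  then show ?case
    using count_free_below_1_right by simp
next
  case (Suc m)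
  then show ?case
    by (auto simp: count_free_below_Suc[of "Suc m"] intro!: sum.cong)
qed

lemma count_free_below_Suc_eq_sum:
  assumes "1 \<le> c" "c \<le> m"
  shows "count_free_below (Suc m) c = (\<Sum>a=c-1..m. count_free_below m a)"
proof -
  let ?t = "\<lambda>a. if 0 < a \<and> a < m \<longrightarrow> c \<le> a then count_free_below m (if a = 0 then c - 1 else a) else 0"
  have "count_free_below (Suc m) c = ?t 0 + (\<Sum>a=Suc 0..m. ?t a)"
    unfolding count_free_below_Suc atMost_atLeast0 by (rule sum.atLeast_Suc_atMost) simp
  also have "(\<Sum>a=Suc 0..m. ?t a) = (\<Sum>a=c..m. count_free_below m a)"
    using assms by (intro sum.mono_neutral_cong_right) auto
  finally show ?thesis
    using assms sum.atLeast_Suc_atMost[of "c - 1" m "count_free_below m"] by simp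
qed

lemma count_free_below_Suc_diff:
  assumes "1 \<le> c" "c < m"
  shows "count_free_below (Suc m) c = count_free_below (Suc m) (Suc c) + count_free_below m (c - 1)"
  using assms count_free_below_Suc_eq_sum[of c m] count_free_below_Suc_eq_sum[of "Suc c" m]
    sum.atLeast_Suc_atMost[of "c - 1" m "count_free_below m"]
  by simp

lemma count_free_below_Suc_eq_power: "count_free_below (Suc m) m = 2 ^ m"
proof (induction m)
  case 0
  then show ?case
    by (simp add: count_free_below_Suc count_free_below_0)
next
  case (Suc m)
  then show ?case
    using count_free_below_Suc_self[of m] by (simp add: count_free_below_Suc_eq_sum)
qed

lemma sum_choose_Suc_interval:
  assumes "a \<le> b"
  shows "(\<Sum>i=Suc a..Suc b. Suc N choose i) = (\<Sum>i=a..Suc b. N choose i) + (\<Sum>i=Suc a..b. N choose i)"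
proof -
  have "(\<Sum>i=Suc a..Suc b. Suc N choose i) = (\<Sum>i=a..b. N choose i) + (\<Sum>i=a..b. N choose Suc i)"
    by (simp add: sum.shift_bounds_cl_Suc_ivl sum.distrib del: sum.cl_ivl_Suc)
  also have "(\<Sum>i=a..b. N choose Suc i) = (N choose Suc b) + (\<Sum>i=Suc a..b. N choose i)"
    using assms by (simp add: sum.shift_bounds_cl_Suc_ivl[symmetric])
  finally show ?thesis
    using assms by simp
qed

text \<open>The window is symmetric about the middle of row \<open>2 * p - k\<close>.\<close>

definition binomial_window :: "nat \<Rightarrow> nat \<Rightarrow> nat" where
  "binomial_window p k = (\<Sum>i=p-k..p. (2 * p - k) choose i)"

lemma binomial_window_0: "binomial_window p 0 = (2 * p) choose p"
  by (simp add: binomial_window_def)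

lemma binomial_window_1: "binomial_window (Suc p) 1 = binomial_window (Suc p) 0"
  by (simp add: binomial_window_def)

lemma binomial_window_self: "binomial_window p p = 2 ^ p"
  using choose_row_sum[of p] by (simp add: binomial_window_def atMost_atLeast0)

lemma binomial_window_Suc_diff:
  assumes "1 \<le> k" "k \<le> p"
  shows "binomial_window (Suc p) k = binomial_window (Suc p) (Suc k) + binomial_window p (k - 1)"
proof -
  have eqs: "Suc p - k = Suc (p - k)" "2 * Suc p - k = Suc (Suc (2 * p) - k)"
    "2 * Suc p - Suc k = Suc (2 * p) - k" "p - (k - 1) = Suc (p - k)" "2 * p - (k - 1) = Suc (2 * p) - k"
    using assms by auto
  show ?thesis
    unfolding binomial_window_def eqs diff_Suc_Suc by (rule sum_choose_Suc_interval) simp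
qed

lemma count_free_below_Suc_eq_binomial_window: "k \<le> p \<Longrightarrow> count_free_below (Suc p) k = binomial_window p k"
proof (induction p arbitrary: k)
  case 0
  then show ?case
    by (simp add: count_free_below_Suc count_free_below_0 binomial_window_0)
next
  case (Suc p)
  have pos: "count_free_below (Suc (Suc p)) k = binomial_window (Suc p) k" if "1 \<le> k" "k \<le> Suc p" for k
    using that(2,1)
  proof (induction k rule: inc_induct)
    case base
    show ?case
      by (simp only: count_free_below_Suc_eq_power binomial_window_self)
  next
    case (step k)
    then show ?case
      using Suc.IH[of "k - 1"] by (simp add: count_free_below_Suc_diff[of k] binomial_window_Suc_diff)
  qed
  show ?case
  proof (cases "k = 0")
    case True
    then show ?thesis
      using pos[of 1] count_free_below_1_right binomial_window_1 by simp
  qed (use pos Suc.prems in simp)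
qed

lemma card_admissible_words_Suc: "card (admissible_words (Suc p)) = (2 * p) choose p"
  using count_free_below_Suc_eq_binomial_window[of 0 p]
  by (simp add: count_free_below_def words_free_below_0 binomial_window_0)

section \<open>Generating functions\<close>

lemma gbinomial_minus_half:
  "((- (1 / 2) :: 'a::field_char_0) gchoose n) = (- 1 / 4) ^ n * of_nat ((2 * n) choose n)"
proof (induction n)
  case (Suc n)
  have central: "of_nat ((2 * k) choose k) = (fact (2 * k) :: 'a) / (fact k * fact k)" for k
    by (simp add: binomial_fact)
  have "((- (1 / 2) :: 'a) gchoose Suc n) = (- (1 / 2) gchoose n) * (- (1 / 2) - of_nat n) / of_nat (Suc n)"
    using gbinomial_mult_1[of "- (1 / 2) :: 'a" n] by (simp add: field_simps del: of_nat_Suc)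
  also have "\<dots> = (- 1 / 4) ^ Suc n * of_nat ((2 * Suc n) choose Suc n)"
    unfolding Suc central
    by (simp add: divide_simps del: of_nat_Suc) (simp add: algebra_simps)
  finally show ?case .
qed simp

lemma fps_sqrt1_eqI:
  assumes "f\<^sup>2 = g" "f $ 0 = 1"
  shows "fps_sqrt1 g = f"
proof -
  have "g $ 0 = 1"
    using assms by (auto simp: power2_eq_square)
  then show ?thesis
    using radical_unique[of "\<lambda>_ _. 1" 1 g f] assms by (simp add: fps_sqrt1_def numeral_2_eq_2)
qed

lemma inverse_fps_sqrt1_one_minus_4X:
  "1 / fps_sqrt1 (1 - 4 * fps_X :: 'a::field_char_0 fps) = Abs_fps (\<lambda>n. of_nat ((2 * n) choose n))"
proof -
  let ?x = "fps_const (- 4) * fps_X :: 'a fps"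
  let ?r = "fps_binomial (1 / 2) oo ?x" and ?s = "fps_binomial (- (1 / 2)) oo ?x"
  have mult: "(fps_binomial a oo ?x) * (fps_binomial b oo ?x) = fps_binomial (a + b) oo ?x" for a b
    by (simp add: fps_binomial_add_mult fps_compose_mult_distrib)
  have "?r\<^sup>2 = (1 + fps_X) oo ?x"
    by (simp add: power2_eq_square mult fps_binomial_1)
  also have "\<dots> = 1 - 4 * fps_X"
    by (simp add: fps_compose_add_distrib fps_numeral_fps_const fps_const_neg[symmetric] del: fps_const_neg)
  finally have "fps_sqrt1 (1 - 4 * fps_X) = ?r"
    by (rule fps_sqrt1_eqI) simp
  then have "1 / fps_sqrt1 (1 - 4 * fps_X) = inverse ?r"
    by (simp add: fps_divide_unit)
  also have "?r * ?s = 1"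
    by (simp add: mult)
  then have "inverse ?r = ?s"
    by (rule fps_inverse_unique)
  also have "?s = Abs_fps (\<lambda>n. of_nat ((2 * n) choose n))"
    by (rule fps_ext) (simp add: gbinomial_minus_half power_mult_distrib[symmetric] mult.assoc[symmetric])
  finally show ?thesis .
qed

definition free_below_poly :: "'a::comm_ring_1 \<Rightarrow> nat \<Rightarrow> 'a" where
  "free_below_poly v m = (\<Sum>b\<le>m. of_nat (count_free_below m b) * v ^ b)"

lemma one_minus_times_sum_power:
  fixes v :: "'a::comm_ring_1"
  shows "(1 - v) * (\<Sum>b\<le>m. f b * v ^ b) = f 0 + (\<Sum>b<m. (f (Suc b) - f b) * v ^ Suc b) - f m * v ^ Suc m"
  by (induction m) (simp_all add: algebra_simps)

lemma free_below_poly_0: "free_below_poly v 0 = 1"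
  by (simp add: free_below_poly_def count_free_below_0)

lemma free_below_poly_1: "free_below_poly v (Suc 0) = 1 + v"
  using count_free_below_Suc_eq_power[of 0] count_free_below_Suc_self[of 0] by (simp add: free_below_poly_def)

lemma free_below_poly_Suc_Suc:
  "(1 - v) * free_below_poly v (Suc (Suc k)) + v\<^sup>2 * free_below_poly v (Suc k) =
    of_nat ((2 * Suc k) choose Suc k) + (1 - v) * v\<^sup>2 * (2 * v) ^ k"
proof -
  define f g where "f b = (of_nat (count_free_below (Suc (Suc k)) b) :: 'a)"
    and "g b = (of_nat (count_free_below (Suc k) b) :: 'a)" for b
  have f_0: "f 0 = of_nat ((2 * Suc k) choose Suc k)" and f_1: "f (Suc 0) = f 0"
    and f_top: "f (Suc (Suc k)) = f (Suc k)" "f (Suc k) = 2 * 2 ^ k"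
    using count_free_below_1_right[of "Suc (Suc k)"] card_admissible_words_Suc[of "Suc k"]
      count_free_below_Suc_self[of "Suc k"] count_free_below_Suc_eq_power[of "Suc k"]
    by (simp_all add: f_def count_free_below_def words_free_below_0)
  have g_top: "g (Suc k) = 2 ^ k" "g k = 2 ^ k"
    using count_free_below_Suc_self[of k] count_free_below_Suc_eq_power[of k] by (simp_all add: g_def)
  have f_g: "f (Suc (Suc b)) - f (Suc b) = - g b" if "b < k" for b
    using count_free_below_Suc_diff[of "Suc b" "Suc k"] that by (simp add: f_def g_def)
  have "(\<Sum>b<Suc (Suc k). (f (Suc b) - f b) * v ^ Suc b) = (\<Sum>b<Suc k. (f (Suc b) - f b) * v ^ Suc b)"
    by (simp add: f_top(1))
  also have "\<dots> = (\<Sum>b<k. (f (Suc (Suc b)) - f (Suc b)) * v ^ Suc (Suc b))"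
    by (subst sum.lessThan_Suc_shift) (simp add: f_1)
  also have "\<dots> = - (v\<^sup>2 * (\<Sum>b<k. g b * v ^ b))"
    by (simp add: f_g sum_negf sum_distrib_left power2_eq_square mult_ac)
  finally have "(1 - v) * (\<Sum>b\<le>Suc (Suc k). f b * v ^ b) =
      f 0 - v\<^sup>2 * (\<Sum>b<k. g b * v ^ b) - 2 * 2 ^ k * v ^ (k + 3)"
    unfolding one_minus_times_sum_power by (simp add: f_top power_add numeral_3_eq_3 mult_ac)
  moreover have "(\<Sum>b\<le>Suc k. g b * v ^ b) = (\<Sum>b<k. g b * v ^ b) + 2 ^ k * v ^ k + 2 ^ k * v ^ Suc k"
    by (simp add: g_top lessThan_Suc_atMost[symmetric])
  ultimately show ?thesis
    by (simp add: free_below_poly_def f_def[symmetric] g_def[symmetric] f_0 power_mult_distrib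
        algebra_simps power2_eq_square power_add numeral_3_eq_3)
qed

definition free_below_gf :: "'a::comm_ring_1 \<Rightarrow> 'a fps" where
  "free_below_gf v = Abs_fps (free_below_poly v)"

lemma free_below_gf_kernel_equation:
  "(1 - fps_const v + fps_X * (fps_const v)\<^sup>2) * free_below_gf v =
    (1 - fps_const v) * (1 + (fps_X * fps_const v)\<^sup>2 * Abs_fps (\<lambda>n. (2 * v) ^ n))
    + fps_X * Abs_fps (\<lambda>n. of_nat ((2 * n) choose n))"
    (is "?K * _ = ?rhs")
proof (rule fps_ext)
  fix n
  have K: "?K = fps_const (1 - v) + fps_X * fps_const (v\<^sup>2)"
    by (simp add: fps_const_power[symmetric] fps_const_sub[symmetric] del: fps_const_power fps_const_sub)
  have lhs: "(?K * free_below_gf v) $ n =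
      (1 - v) * free_below_poly v n + (if n = 0 then 0 else v\<^sup>2 * free_below_poly v (n - 1))"
    unfolding K by (simp add: distrib_right mult.assoc free_below_gf_def)
  have R: "?rhs = fps_const (1 - v) + fps_X\<^sup>2 * (fps_const ((1 - v) * v\<^sup>2) * Abs_fps (\<lambda>n. (2 * v) ^ n))
      + fps_X * Abs_fps (\<lambda>n. of_nat ((2 * n) choose n))"
    by (simp add: fps_const_power[symmetric] fps_const_sub[symmetric] fps_const_mult[symmetric]
        power_mult_distrib distrib_left mult_ac del: fps_const_power fps_const_sub fps_const_mult)
  have rhs: "?rhs $ n = (if n = 0 then 1 - v else 0) +
      (if n < 2 then 0 else (1 - v) * v\<^sup>2 * (2 * v) ^ (n - 2)) +
      (if n = 0 then 0 else of_nat ((2 * (n - 1)) choose (n - 1)))"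
    unfolding R by (simp add: fps_X_power_mult_nth)
  consider (zero) "n = 0" | (one) "n = 1" | (Suc_Suc) k where "n = Suc (Suc k)"
    by (metis One_nat_def old.nat.exhaust)
  then show "(?K * free_below_gf v) $ n = ?rhs $ n"
  proof cases
    case Suc_Suc
    then show ?thesis
      unfolding lhs rhs using free_below_poly_Suc_Suc[of v k] by simp
  qed (unfold lhs rhs, simp_all add: free_below_poly_0 free_below_poly_1 algebra_simps power2_eq_square)
qed

lemma free_below_gf_closed_form:
  fixes v :: "'a::field_char_0"
  defines "V \<equiv> fps_const v"
  assumes "v \<noteq> 1"
  shows "free_below_gf v =
    ((1 - V) * (1 - fps_X * V)\<^sup>2) / ((1 - 2 * fps_X * V) * (1 - V + fps_X * V\<^sup>2))
    + fps_X / (1 - V + fps_X * V\<^sup>2) * (1 / fps_sqrt1 (1 - 4 * fps_X))"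
proof -
  define K P where "K = 1 - V + fps_X * V\<^sup>2" and "P = 1 - 2 * fps_X * V"
  let ?S = "1 / fps_sqrt1 (1 - 4 * fps_X) :: 'a fps"
  have units: "K $ 0 \<noteq> 0" "P $ 0 \<noteq> 0"
    using \<open>v \<noteq> 1\<close> by (simp_all add: K_def P_def V_def)
  have "P = 1 - fps_const (2 * v) * fps_X"
    by (simp add: P_def V_def fps_const_mult[symmetric] fps_numeral_fps_const mult_ac del: fps_const_mult)
  then have geometric: "Abs_fps (\<lambda>n. (2 * v) ^ n) = inverse P"
    using one_minus_const_fps_X_neg_power'[of 1 "2 * v"] by simp
  have "K * free_below_gf v = (1 - V) * (1 + (fps_X * V)\<^sup>2 * inverse P) + fps_X * ?S"
    unfolding K_def V_def geometric[symmetric] inverse_fps_sqrt1_one_minus_4X by (rule free_below_gf_kernel_equation)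
  also have "1 + (fps_X * V)\<^sup>2 * inverse P = (P + (fps_X * V)\<^sup>2) * inverse P"
    using inverse_mult_eq_1'[OF units(2)] by (simp add: distrib_right)
  also have "P + (fps_X * V)\<^sup>2 = (1 - fps_X * V)\<^sup>2"
    by (simp add: P_def algebra_simps power2_eq_square)
  finally have "free_below_gf v = inverse K * ((1 - V) * ((1 - fps_X * V)\<^sup>2 * inverse P) + fps_X * ?S)"
    using inverse_mult_eq_1[OF units(1)] by (metis mult.assoc mult_1)
  then show ?thesis
    unfolding K_def[symmetric] P_def[symmetric]
    using units by (simp add: fps_divide_unit fps_inverse_mult distrib_left mult_ac)
qed

section \<open>Triangular permutations as words\<close>

lemma bij_betw_map_permutes:
  assumes "distinct xs"
  shows "bij_betw (\<lambda>\<pi>. map \<pi> xs) {\<pi>. \<pi> permutes set xs} (permutations_of_set (set xs))"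
proof -
  let ?f = "\<lambda>\<pi>. map \<pi> xs" and ?P = "{\<pi>. \<pi> permutes set xs}"
  have inj: "inj_on ?f ?P"
  proof (rule inj_onI, unfold mem_Collect_eq)
    fix \<pi> \<sigma> assume "\<pi> permutes set xs" "\<sigma> permutes set xs" "map \<pi> xs = map \<sigma> xs"
    then show "\<pi> = \<sigma>"
      by (metis ext map_eq_conv permutes_not_in)
  qed
  have "?f ` ?P \<subseteq> permutations_of_set (set xs)"
    using assms by (auto intro!: permutations_of_setI simp: permutes_image distinct_map permutes_inj_on)
  moreover have "card (?f ` ?P) = card (permutations_of_set (set xs))"
    using inj by (simp add: card_image card_permutations)
  ultimately have "?f ` ?P = permutations_of_set (set xs)"
    by (intro card_subset_eq) simp_all
  with inj show ?thesis
    by (simp add: bij_betw_def)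
qed

lemma permutes_insert_fixpoint_iff:
  assumes "a \<notin> S"
  shows "\<pi> permutes insert a S \<and> \<pi> a = a \<longleftrightarrow> \<pi> permutes S"
  using assms permutes_superset[of \<pi> "insert a S" S] permutes_subset[of \<pi> S "insert a S"]
    permutes_not_in[of \<pi> S a]
  by auto

definition tail_word :: "nat \<Rightarrow> (nat \<Rightarrow> nat) \<Rightarrow> nat list" where
  "tail_word n \<pi> = map \<pi> [2..<Suc n]"

lemma triangular_iff_tail_word:
  assumes "2 \<le> n"
  shows "triangular n \<pi> \<longleftrightarrow> \<pi> permutes {2..n} \<and> admissible (tail_word n \<pi>)"
proof -
  have interval: "{1..n} = insert 1 {2..n}" "{2..n} = set [2..<Suc n]"
    using assms by auto
  have "\<pi> permutes {1..n} \<and> \<pi> 1 = 1 \<longleftrightarrow> \<pi> permutes {2..n}"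
    unfolding interval(1) by (rule permutes_insert_fixpoint_iff) simp
  moreover have "unblocked \<pi> {1..n} \<longleftrightarrow> admissible (tail_word n \<pi>)" if "\<pi> permutes {1..n}" "\<pi> 1 = 1"
  proof -
    have "\<pi> 1 \<le> \<pi> j" if "j \<in> blocking_positions \<pi> {2..n}" for j
      using permutes_in_image[OF \<open>\<pi> permutes {1..n}\<close>, of j] that \<open>\<pi> 1 = 1\<close>
      by (simp add: blocking_positions_def)
    then have "unblocked \<pi> {1..n} \<longleftrightarrow> unblocked \<pi> {2..n}"
      unfolding interval(1) by (subst unblocked_insert_least) auto
    then show ?thesis
      unfolding tail_word_def interval(2) by (simp add: admissible_map_strict_sorted del: upt_Suc set_upt)
  qed
  ultimately show ?thesis
    using triangular_iff_unblocked[OF assms] by blast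
qed

lemma shifted_admissible_words_eq:
  "map ((+) 2) ` admissible_words m = {w \<in> permutations_of_set {2..Suc m}. admissible w}"
proof -
  have "(+) 2 ` {..<m} = {2..Suc m}"
    unfolding lessThan_atLeast0 image_add_atLeastLessThan by auto
  then have "permutations_of_set {2..Suc m} = map ((+) 2) ` permutations_of_set {..<m}"
    using permutations_of_set_image_inj[of "(+) 2" "{..<m}"] by simp
  moreover have "admissible (map ((+) 2) w) \<longleftrightarrow> admissible w" for w :: "nat list"
    by (rule admissible_map) (simp add: strict_mono_def)
  ultimately show ?thesis
    by (auto simp: admissible_words_def)
qed

lemma bij_betw_tail_word:
  "bij_betw (tail_word (Suc (Suc m))) {\<pi>. triangular (Suc (Suc m)) \<pi>} (map ((+) 2) ` admissible_words (Suc m))"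
proof -
  let ?n = "Suc (Suc m)"
  have "bij_betw (tail_word ?n) {\<pi>. \<pi> permutes {2..?n}} (permutations_of_set {2..?n})"
    using bij_betw_map_permutes[of "[2..<Suc ?n]"]
    by (simp add: tail_word_def[abs_def] atLeastLessThanSuc_atLeastAtMost del: upt_Suc)
  then have "bij_betw (tail_word ?n) {\<pi> \<in> {\<pi>. \<pi> permutes {2..?n}}. admissible (tail_word ?n \<pi>)}
      {w \<in> permutations_of_set {2..?n}. admissible w}"
    by (rule bij_betw_Collect) (rule refl)
  then show ?thesis
    by (simp add: triangular_iff_tail_word shifted_admissible_words_eq)
qed

lemma card_triangular: "card {\<pi>. triangular (Suc (Suc m)) \<pi>} = card (admissible_words (Suc m))"
  using bij_betw_same_card[OF bij_betw_tail_word]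
  by (simp add: card_image inj_on_subset[OF inj_mapI])

lemma tri_count_eq_count_free_below:
  assumes "a \<le> m"
  shows "tri_count (m + 2) (a + 2) = count_free_below m a"
proof -
  let ?n = "Suc (Suc m)"
  have hd_tail_word: "hd (tail_word ?n \<pi>) = \<pi> 2" for \<pi>
    by (simp add: tail_word_def upt_conv_Cons del: upt_Suc)
  have nonempty: "w \<noteq> []" if "w \<in> admissible_words (Suc m)" for w
    using that by (auto simp: admissible_words_def permutations_of_set_lessThan_Suc prepend_rank_def)
  have "tri_count ?n (a + 2) = card {\<pi> \<in> {\<pi>. triangular ?n \<pi>}. hd (tail_word ?n \<pi>) = a + 2}"
    unfolding tri_count_def hd_tail_word by (intro arg_cong[where f = card]) (auto simp: triangular_def)
  also have "\<dots> = card {w \<in> map ((+) 2) ` admissible_words (Suc m). hd w = a + 2}"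
    using bij_betw_Collect[OF bij_betw_tail_word refl] by (rule bij_betw_same_card)
  also have "{w \<in> map ((+) 2) ` admissible_words (Suc m). hd w = a + 2} =
      map ((+) 2) ` {w \<in> words_free_below (Suc m) 0. hd w = a}"
    using nonempty by (auto simp: words_free_below_0 hd_map)
  also have "card \<dots> = count_free_below m a"
    using card_words_free_below_hd[OF assms, of 0] by (simp add: card_image inj_on_subset[OF inj_mapI])
  finally show ?thesis by simp
qed

lemma tri_gf_eq_free_below_gf: "tri_gf = var_x\<^sup>2 * free_below_gf fls_X"
proof (rule fps_ext)
  fix n
  show "tri_gf $ n = (var_x\<^sup>2 * free_below_gf fls_X) $ n"
  proof (cases "n < 2")
    case False
    then obtain m where n: "n = m + 2"
      by (metis add.commute le_Suc_ex not_less)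
    have "tri_gf $ n = (\<Sum>a=0+2..m+2. of_nat (tri_count (m + 2) a) * fls_X ^ (a - 2))"
      by (simp add: n tri_gf_def numeral_2_eq_2 del: sum.cl_ivl_Suc)
    also have "\<dots> = (\<Sum>a\<le>m. of_nat (count_free_below m a) * fls_X ^ a)"
      unfolding sum.shift_bounds_cl_nat_ivl atMost_atLeast0
      by (intro sum.cong) (simp_all only: tri_count_eq_count_free_below add_diff_cancel_right' atLeastAtMost_iff)
    finally show ?thesis
      by (simp add: n var_x_def fps_X_power_mult_nth free_below_gf_def free_below_poly_def)
  qed (simp add: tri_gf_def var_x_def fps_X_power_mult_nth)
qed

lemma tri_gf_closed_form:
  "tri_gf =
    (var_x\<^sup>2 * (1 - var_v) * (1 - var_x * var_v)\<^sup>2)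
      / ((1 - 2 * var_x * var_v) * (1 - var_v + var_x * var_v\<^sup>2))
    + var_x ^ 3 / (1 - var_v + var_x * var_v\<^sup>2) * (1 / fps_sqrt1 (1 - 4 * var_x))"
proof -
  define K P S where "K = 1 - var_v + var_x * var_v\<^sup>2" and "P = 1 - 2 * var_x * var_v"
    and "S = 1 / fps_sqrt1 (1 - 4 * var_x)"
  have "fls_X \<noteq> (1 :: rat fls)"
    by (metis fls_X_nth fls_one_nth zero_neq_one)
  then have "K $ 0 \<noteq> 0" "(P * K) $ 0 \<noteq> 0"
    and "free_below_gf fls_X = ((1 - var_v) * (1 - var_x * var_v)\<^sup>2) / (P * K) + var_x / K * S"
    using free_below_gf_closed_form[of "fls_X :: rat fls"] by (simp_all add: K_def P_def S_def var_x_def var_v_def)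
  then show ?thesis
    unfolding tri_gf_eq_free_below_gf K_def[symmetric] P_def[symmetric] S_def[symmetric]
    by (simp add: fps_divide_unit distrib_left power2_eq_square power3_eq_cube mult_ac)
qed

theorem theorem4p1:
  shows "(\<forall>n. card {\<pi>. triangular (n + 2) \<pi>} = (2 * n) choose n) \<and>
    (let v = var_v; x = var_x in
      tri_gf =
        (x\<^sup>2 * (1 - v) * (1 - x * v)\<^sup>2) / ((1 - 2 * x * v) * (1 - v + x * v\<^sup>2))
        + x ^ 3 / (1 - v + x * v\<^sup>2) * (1 / fps_sqrt1 (1 - 4 * x)))"
proof (intro conjI allI)
  show "card {\<pi>. triangular (n + 2) \<pi>} = (2 * n) choose n" for n
    by (simp add: card_triangular card_admissible_words_Suc)
qed (simp only: Let_def tri_gf_closed_form)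

end
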